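(* Let $q$ be an odd prime power with $q\not\equiv 2\pmod 3$. Then the boomerang uniformity of the power mapping $F_1(x)=x^{q-1}$ over $\mathrm{GF}(q^2)$ is $2$, i.e. $\beta_{F_1}=2$.
   Context: $\mathrm{GF}(Q)$ denotes the finite field with $Q$ elements and $\mathrm{GF}(Q)^*=\mathrm{GF}(Q)\setminus\{0\}$. For a function $F:\mathrm{GF}(Q)\to\mathrm{GF}(Q)$ and $a,b\in\mathrm{GF}(Q)^*$, let $\beta_F(a,b)$ be the number of solutions $(x,y)\in\mathrm{GF}(Q)\times\mathrm{GF}(Q)$ of the system $F(x)-F(y)=b$, $F(x+a)-F(y+a)=b$. The boomerang uniformity of $F$ is $\beta_F=\max_{a,b\in\mathrm{GF}(Q)^*}\beta_F(a,b)$. Here $Q=q^2$.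
   Formalization: The case q = 3 is excluded: there F_1(x) = x^2 on GF(9), the system has no solutions for nonzero a, b, and the boomerang uniformity is 0 rather than 2. *)

theory Defs
  imports "HOL-Number_Theory.Prime_Powers" "HOL-Library.Cardinality"
begin

definition boomerang_count :: "('a :: {field, finite} \<Rightarrow> 'a) \<Rightarrow> 'a \<Rightarrow> 'a \<Rightarrow> nat" where
  "boomerang_count F a b = card {(x, y). F x - F y = b \<and> F (x + a) - F (y + a) = b}"

definition boomerang_uniformity :: "('a :: {field, finite} \<Rightarrow> 'a) \<Rightarrow> nat" where
  "boomerang_uniformity F = Max {boomerang_count F a b | a b. a \<noteq> 0 \<and> b \<noteq> 0}"

end

theory Submission
  imports Defs "HOL-Number_Theory.Residues" "HOL-Computational_Algebra.Polynomial"
begin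

text \<open>
  Scaling reduces the count to \<open>a = 1\<close>. For \<open>x \<noteq> 0\<close> the value \<open>F x = x\<^sup>q / x\<close> has norm one, and a
  nonzero \<open>b\<close> is a difference \<open>u - v\<close> of norm-one elements in at most two ways, which are exchanged
  by \<open>(u, v) \<mapsto> (- v, - u)\<close>. Hence a solution \<open>(x, y)\<close> avoiding \<open>0\<close> and \<open>-1\<close> satisfies
  \<open>F (x + 1) = - F y\<close> and \<open>F (y + 1) = - F x\<close>: \<open>x\<close> and \<open>y\<close> have the same trace \<open>t\<close>, and
  \<open>x y\<^sup>q + x\<^sup>q y = - t\<close>. These relations express \<open>x\<close> and \<open>y\<close> through \<open>d = y - x\<close> and \<open>b\<close>, and
  determine \<open>d\<^sup>2\<close> in terms of \<open>b\<close>, so there are at most two solutions. Solutions come in pairs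
  \<open>(x, y)\<close>, \<open>(- 1 - x, - 1 - y)\<close>, and one is \<open>(1 + u, 1 + 2 / u)\<close> for any \<open>u \<noteq> 0\<close> with
  \<open>u\<^sup>q = - u\<close> and \<open>u\<^sup>2 \<noteq> 2\<close>.
\<close>

section \<open>Finite-field preliminaries\<close>

text \<open>Multiplication by \<open>x \<noteq> 0\<close> permutes the nonzero elements, so
  comparing their product before and after gives \<open>x ^ (CARD('a) - 1) = 1\<close>.\<close>

lemma power_card_eq_self:
  fixes x :: "'a :: {field, finite}"
  shows "x ^ CARD('a) = x"
proof (cases "x = 0")
  case False
  let ?P = "\<Prod>(UNIV - {0 :: 'a})"
  have "bij_betw ((*) x) (UNIV - {0}) (UNIV - {0})"
    by (rule bij_betw_byWitness[where f' = "\<lambda>y. y / x"]) (use False in auto)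
  then have "?P = (\<Prod>y\<in>UNIV - {0}. x * y)"
    by (rule prod.reindex_bij_betw[symmetric])
  also have "\<dots> = x ^ (CARD('a) - 1) * ?P"
    by (simp add: prod.distrib card_Diff_singleton)
  finally have "x ^ (CARD('a) - 1) = 1"
    by simp
  then have "x * x ^ (CARD('a) - 1) = x"
    by simp
  then show ?thesis
    by (simp flip: power_Suc)
qed simp

text \<open>Dividing both coordinates by \<open>a\<close> is injective and sends solutions for
  \<open>a\<close> to solutions for \<open>1\<close>; the inequality suffices for an upper
  bound.\<close>

lemma boomerang_count_power_scale:
  fixes a b :: "'a :: {field, finite}"
  assumes "a \<noteq> 0"
  shows "boomerang_count (\<lambda>x. x ^ n) a b \<le> boomerang_count (\<lambda>x. x ^ n) 1 (b / a ^ n)"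
  unfolding boomerang_count_def
proof (rule card_inj_on_le)
  show "inj_on (\<lambda>(x, y). (x / a, y / a)) {(x, y). x ^ n - y ^ n = b \<and> (x + a) ^ n - (y + a) ^ n = b}"
    using assms by (auto simp: inj_on_def)
  show "(\<lambda>(x, y). (x / a, y / a)) ` {(x, y). x ^ n - y ^ n = b \<and> (x + a) ^ n - (y + a) ^ n = b}
      \<subseteq> {(x, y). x ^ n - y ^ n = b / a ^ n \<and> (x + 1) ^ n - (y + 1) ^ n = b / a ^ n}"
  proof clarsimp
    fix x y assume h: "(x + a) ^ n - (y + a) ^ n = x ^ n - y ^ n"
    have "x / a + 1 = (x + a) / a" "y / a + 1 = (y + a) / a"
      using assms by (simp_all add: add_divide_distrib)
    then show "(x / a) ^ n - (y / a) ^ n = (x ^ n - y ^ n) / a ^ n \<and>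
        (x / a + 1) ^ n - (y / a + 1) ^ n = (x ^ n - y ^ n) / a ^ n"
      by (simp only: power_divide h flip: diff_divide_distrib)
  qed
qed simp

lemma card_square_roots_le:
  fixes c :: "'a :: idom"
  shows "finite {x. x ^ 2 = c}" "card {x. x ^ 2 = c} \<le> 2"
proof -
  have "finite {x. x ^ 2 = c} \<and> card {x. x ^ 2 = c} \<le> 2"
  proof (cases "\<exists>r. r ^ 2 = c")
    case True
    then obtain r where "r ^ 2 = c" ..
    then have "{x. x ^ 2 = c} = {r, - r}"
      by (auto simp: power2_eq_iff)
    then show ?thesis
      by (simp add: card_insert_if)
  next
    case False
    then have "{x. x ^ 2 = c} = {}"
      by simp
    then show ?thesis
      by (metis card.empty finite.emptyI zero_le)
  qed
  then show "finite {x. x ^ 2 = c}" "card {x. x ^ 2 = c} \<le> 2"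
    by simp_all
qed

section \<open>Conjugation in a quadratic extension and the map \<open>F\<close>\<close>

locale odd_quadratic_extension =
  fixes q :: nat and field_type :: "'a :: {field, finite} itself"
  assumes primepow: "primepow q" and odd: "odd q" and card: "CARD('a) = q\<^sup>2"
begin

definition F :: "'a \<Rightarrow> 'a" where
  "F x = x ^ (q - 1)"

lemma q_gt_1: "q > 1"
  using primepow primepow_gt_Suc_0 by auto

lemma q_ge_3: "q \<ge> 3"
  using q_gt_1 odd by (cases "q = 2") auto

text \<open>Since \<open>q\<close> is a power of the characteristic, the map \<open>x ^ q\<close> is
  additive; it is the conjugation over the subfield with \<open>q\<close> elements.\<close>

lemma q_power_char: "prime CHAR('a) \<and> (\<exists>k>0. q = CHAR('a) ^ k)"
proof -
  obtain p k where pk: "prime p" "k > 0" "q = p ^ k"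
    using primepow by (auto simp: primepow_def)
  have "CHAR('a) > 0"
    by (rule finite_imp_CHAR_pos) simp
  then have prime: "prime CHAR('a)"
    by (rule prime_CHAR_semidom)
  have "CHAR('a) dvd p ^ (k * 2)"
    using CHAR_dvd_CARD[where 'a = 'a] card pk by (simp add: power_mult)
  then have "CHAR('a) = p"
    using prime pk(1) prime_dvd_power primes_dvd_imp_eq by blast
  with prime pk show ?thesis
    by blast
qed

lemma conj_add: "(x + y :: 'a) ^ q = x ^ q + y ^ q"
  using q_power_char freshmans_dream' by blast

lemma conj_minus: "(- x :: 'a) ^ q = - (x ^ q)"
  using odd by simp

lemma conj_diff: "(x - y :: 'a) ^ q = x ^ q - y ^ q"
  using conj_add[of x "- y"] conj_minus[of y] by simp

lemma conj_conj: "((x :: 'a) ^ q) ^ q = x"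
  using power_card_eq_self[of x] by (simp add: card power2_eq_square power_mult)

lemma two_neq_zero: "(2 :: 'a) \<noteq> 0"
proof
  assume "(2 :: 'a) = 0"
  then have "CHAR('a) dvd 2"
    using of_nat_eq_0_iff_char_dvd[where 'a = 'a, of 2] by simp
  then have "CHAR('a) = 2"
    using q_power_char primes_dvd_imp_eq two_is_prime_nat by blast
  then show False
    using q_power_char odd by auto
qed

lemma three_eq_zero:
  assumes "3 dvd q"
  shows "(3 :: 'a) = 0"
proof -
  have "prime (3 :: nat)"
    by (simp add: prime_nat_numeral_eq)
  then have "CHAR('a) = 3"
    using assms q_power_char by (metis prime_dvd_power primes_dvd_imp_eq)
  then show ?thesis
    using of_nat_CHAR[where 'a = 'a] by simp
qed

lemma F_zero: "F 0 = 0"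
  using q_gt_1 by (simp add: F_def)

lemma F_one: "F 1 = 1"
  by (simp add: F_def)

lemma F_minus: "F (- x) = F x"
  using odd by (simp add: F_def)

lemma F_eq: "x \<noteq> 0 \<Longrightarrow> F x = x ^ q / x"
  using q_gt_1 by (simp add: F_def power_diff)

text \<open>Conjugation is an involution, so it inverts \<open>x ^ q / x\<close>. At
  \<open>x = 0\<close> the equation survives through the convention
  \<open>inverse 0 = 0\<close>.\<close>

lemma conj_F: "F x ^ q = inverse (F x)"
proof (cases "x = 0")
  case True
  then show ?thesis
    using q_gt_1 by (simp add: F_zero)
next
  case False
  then show ?thesis
    by (simp add: F_eq power_divide conj_conj)
qed

lemma F_eq_zero_iff: "F x = 0 \<longleftrightarrow> x = 0"
  using q_gt_1 by (simp add: F_def)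

lemma F_eq_one_iff: "F x = 1 \<longleftrightarrow> x \<noteq> 0 \<and> x ^ q = x"
proof (cases "x = 0")
  case True
  then show ?thesis
    by (simp add: F_zero)
next
  case False
  then show ?thesis
    by (simp add: F_eq)
qed

section \<open>Solutions for \<open>a = 1\<close>: symmetries and excluded points\<close>

definition solutions :: "'a \<Rightarrow> ('a \<times> 'a) set" where
  "solutions b = {(x, y). F x - F y = b \<and> F (x + 1) - F (y + 1) = b}"

lemma solutions_swap: "(x, y) \<in> solutions b \<Longrightarrow> (y, x) \<in> solutions (- b)"
  unfolding solutions_def by simp (metis minus_diff_eq)

lemma F_reflect: "F (- 1 - x) = F (x + 1)" "F (- 1 - x + 1) = F x"
  using F_minus[of "x + 1"] F_minus[of x] by (simp_all add: algebra_simps)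

text \<open>As \<open>F\<close> is even, \<open>x \<mapsto> - 1 - x\<close> exchanges the two
  equations of the system.\<close>

lemma solutions_reflect: "(x, y) \<in> solutions b \<Longrightarrow> (- 1 - x, - 1 - y) \<in> solutions b"
  unfolding solutions_def mem_Collect_eq case_prod_conv F_reflect by blast

text \<open>A solution with \<open>x = 0\<close> would make \<open>F y\<close> a root of \<open>T\<^sup>2 + T + 1\<close> in the group of norm-one
  elements; outside the case \<open>q \<equiv> 2 (mod 3)\<close> this forces \<open>F y = 1\<close>.\<close>

lemma no_solution_at_0:
  assumes "q mod 3 \<noteq> 2" "b \<noteq> 0"
  shows "(0, y) \<notin> solutions b"
proof
  assume "(0, y) \<in> solutions b"
  then have "- F y = b" and "1 - F (y + 1) = b"
    by (auto simp: solutions_def F_zero F_one)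
  then have b: "b = - F y" and v: "F (y + 1) = 1 + F y"
    by (metis, metis add_uminus_conv_diff diff_eq_eq minus_minus add_diff_cancel_left' diff_add_cancel diff_minus_eq_add)
  define u where "u = F y"
  have u0: "u \<noteq> 0"
    using assms b by (auto simp: u_def)
  have "y + 1 \<noteq> 0"
  proof
    assume y: "y + 1 = 0"
    then have "y = - 1"
      by (simp add: eq_neg_iff_add_eq_0)
    then have "F y = 1"
      by (simp add: F_minus F_one)
    with v y F_zero have "(2 :: 'a) = 0"
      by simp
    then show False
      using two_neq_zero by simp
  qed
  then have "1 + u \<noteq> 0"
    using v F_eq_zero_iff u_def by metis
  \<comment> \<open>Conjugate \<open>F (y + 1) = 1 + F y\<close>: conjugation inverts the values of
    \<open>F\<close>.\<close>
  moreover have "1 + inverse u = inverse (1 + u)"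
    using conj_F[of "y + 1"] conj_F[of y] conj_add[of 1 u] v by (simp add: u_def)
  ultimately have "(1 + inverse u) * (1 + u) = 1"
    by simp
  then have root: "u\<^sup>2 + u + 1 = 0"
    using u0 by (simp add: field_simps power2_eq_square)
  have "u ^ 3 - 1 = (u - 1) * (u\<^sup>2 + u + 1)"
    by (simp add: power2_eq_square power3_eq_cube algebra_simps)
  then have cube: "u ^ 3 = 1"
    by (simp add: root)
  have "u = 1"
  \<comment> \<open>In characteristic 3 the polynomial is \<open>(T - 1)\<^sup>2\<close>. If
    \<open>q mod 3 = 1\<close>, then \<open>u ^ 3 = 1\<close> makes \<open>u\<close> fixed under
    conjugation, while norm one makes conjugation invert it.\<close>
  proof (cases "q mod 3 = 0")
    case True
    then have "(3 :: 'a) = 0"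
      using three_eq_zero by auto
    moreover have "(u - 1)\<^sup>2 = (u\<^sup>2 + u + 1) - 3 * u"
      by (simp add: power2_eq_square algebra_simps)
    ultimately have "(u - 1)\<^sup>2 = 0"
      by (simp add: root)
    then show ?thesis
      by simp
  next
    case False
    then have "q mod 3 = 1"
      using assms by linarith
    then have "q = 3 * (q div 3) + 1"
      by presburger
    then have "u ^ q = (u ^ 3) ^ (q div 3) * u"
      by (metis power_add power_mult power_one_right)
    then have "u ^ q = u"
      by (simp add: cube)
    then have "u = inverse u"
      using conj_F[of y] by (simp add: u_def)
    then have "u * u = 1"
      using u0 by (metis right_inverse)
    with cube show ?thesis
      by (simp add: power3_eq_cube)
  qed
  \<comment> \<open>Now \<open>y\<close> lies in the subfield with \<open>q\<close> elements, hence
    so does \<open>y + 1\<close>, and \<open>F (y + 1) = 1 + F y\<close> becomes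
    \<open>1 = 1 + 1\<close>.\<close>
  then have "y ^ q = y"
    using F_eq_one_iff[of y] u_def by simp
  then have "F (y + 1) = 1"
    using F_eq_one_iff[of "y + 1"] \<open>y + 1 \<noteq> 0\<close> conj_add[of y 1] by simp
  with v \<open>u = 1\<close> show False
    by (simp add: u_def)
qed

text \<open>Swapping and reflecting carry each of the four cases to a vanishing first
  coordinate.\<close>

lemma solution_nonzero:
  assumes "q mod 3 \<noteq> 2" "b \<noteq> 0" "(x, y) \<in> solutions b"
  shows "x \<noteq> 0" "y \<noteq> 0" "x + 1 \<noteq> 0" "y + 1 \<noteq> 0"
proof -
  have fst_nonzero: "x \<noteq> 0" if "b \<noteq> 0" "(x, y) \<in> solutions b" for x y b
    using no_solution_at_0 assms(1) that by blast
  have "- 1 - x \<noteq> 0" "- 1 - y \<noteq> 0"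
    using fst_nonzero[OF assms(2) solutions_reflect[OF assms(3)]]
      fst_nonzero[OF _ solutions_swap[OF solutions_reflect[OF assms(3)]]] assms(2) by auto
  then show "x + 1 \<noteq> 0" "y + 1 \<noteq> 0"
    by (metis add.commute eq_iff_diff_eq_0 add_eq_0_iff)+
  show "x \<noteq> 0" "y \<noteq> 0"
    using fst_nonzero[OF assms(2,3)] fst_nonzero[OF _ solutions_swap[OF assms(3)]] assms(2) by auto
qed

text \<open>Conjugating \<open>u - v = b\<close> for \<open>u\<close>, \<open>v\<close> of norm one gives \<open>u v = - b / b\<^sup>q\<close>, so \<open>u\<close> and \<open>- v\<close>
  are the two roots of a quadratic equation that depends on \<open>b\<close> only.\<close>

lemma unit_differences:
  fixes u v u' v' :: 'a
  assumes units: "u ^ q = inverse u" "v ^ q = inverse v" "u' ^ q = inverse u'" "v' ^ q = inverse v'"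
    and nz: "u \<noteq> 0" "v \<noteq> 0" "u' \<noteq> 0" "v' \<noteq> 0"
    and diff: "u - v = b" "u' - v' = b" and "b \<noteq> 0"
  shows "u' = u \<and> v' = v \<or> u' = - v \<and> v' = - u"
proof -
  have "(inverse w - inverse z) * (w * z) = - (w - z)" if "w \<noteq> 0" "z \<noteq> 0" for w z :: 'a
    using that by (simp add: field_simps)
  then have "(u - v) ^ q * (u * v) = - (u - v)" "(u' - v') ^ q * (u' * v') = - (u' - v')"
    using units nz by (simp_all add: conj_diff)
  then have "b ^ q * (u * v) = - b" "b ^ q * (u' * v') = - b"
    by (simp_all add: diff)
  moreover have "b ^ q \<noteq> 0"
    using \<open>b \<noteq> 0\<close> by simp
  ultimately have "u * v = u' * v'"
    by (metis mult_left_cancel)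
  then have "(u' - u) * (u' + v) = 0"
  proof -
    have "(u' - u) * (u' + (u - b)) = u' * (u' - b) - u * (u - b)"
      by (simp add: algebra_simps)
    moreover have "v = u - b" "v' = u' - b"
      unfolding diff(1)[symmetric] using diff by (simp_all add: algebra_simps)
    ultimately show ?thesis
      using \<open>u * v = u' * v'\<close> by simp
  qed
  then consider "u' = u" | "u' = - v"
    by (auto simp: eq_neg_iff_add_eq_0)
  then show ?thesis
  proof cases
    case 1
    then show ?thesis
      using diff by (metis diff_diff_eq2 add_diff_cancel_left')
  next
    case 2
    have "v' = u' - b"
      unfolding diff(2)[symmetric] by simp
    also have "\<dots> = - u"
      unfolding 2 diff(1)[symmetric] by simp
    finally show ?thesis
      using 2 by simp
  qed
qed

section \<open>Trace relations and the upper bound\<close>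

text \<open>By \<open>unit_differences\<close> the second equation either repeats the values
  \<open>F x\<close>, \<open>F y\<close> or has them negated and exchanged. The former puts
  \<open>x\<close> and \<open>y\<close> in the subfield, where \<open>F\<close> is 1, contradicting
  \<open>b \<noteq> 0\<close>; the latter is the pair of trace relations after clearing
  denominators. The converse serves to verify the explicit solution.\<close>

lemma solution_iff_trace:
  assumes nz: "x \<noteq> 0" "y \<noteq> 0" "x + 1 \<noteq> 0" "y + 1 \<noteq> 0" and "b \<noteq> 0"
  shows "(x, y) \<in> solutions b \<longleftrightarrow>
    x + x ^ q = y + y ^ q \<and> x * y ^ q + x ^ q * y = - (x + x ^ q) \<and> F x - F y = b"
proof -
  have F1: "F (x + 1) = (x ^ q + 1) / (x + 1)" "F (y + 1) = (y ^ q + 1) / (y + 1)"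
    using nz conj_add[of x 1] conj_add[of y 1] by (simp_all add: F_eq)
  have cross: "F (x + 1) = - F y \<and> F (y + 1) = - F x \<longleftrightarrow>
    x + x ^ q = y + y ^ q \<and> x * y ^ q + x ^ q * y = - (x + x ^ q)"
  proof -
    have quot: "r / s = - (v / w) \<longleftrightarrow> r * w + v * s = 0" if "s \<noteq> 0" "w \<noteq> 0" for r s v w :: 'a
      using frac_eq_eq[OF that, of r "- v"] by (simp add: eq_neg_iff_add_eq_0)
    have "F (x + 1) = - F y \<longleftrightarrow> (x ^ q + 1) * y + y ^ q * (x + 1) = 0"
      unfolding F1 F_eq[OF nz(2)] by (rule quot) (use nz in auto)
    moreover have "F (y + 1) = - F x \<longleftrightarrow> (y ^ q + 1) * x + x ^ q * (y + 1) = 0"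
      unfolding F1 F_eq[OF nz(1)] by (rule quot) (use nz in auto)
    moreover have "(X + 1) * y + Y * (x + 1) = (x * Y + X * y) + (y + Y)"
      "(Y + 1) * x + X * (y + 1) = (x * Y + X * y) + (x + X)" for X Y
      by (simp_all add: algebra_simps)
    ultimately show ?thesis
      by (metis add_left_cancel eq_neg_iff_add_eq_0)
  qed
  show ?thesis
  proof
    assume "(x, y) \<in> solutions b"
    then have sol: "F x - F y = b" "F (x + 1) - F (y + 1) = b"
      by (auto simp: solutions_def)
    have "F (x + 1) = F x \<and> F (y + 1) = F y \<or> F (x + 1) = - F y \<and> F (y + 1) = - F x"
      by (rule unit_differences[OF conj_F conj_F conj_F conj_F _ _ _ _ sol \<open>b \<noteq> 0\<close>])
        (use nz F_eq_zero_iff in blast)+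
    moreover have False if eq: "F (x + 1) = F x" "F (y + 1) = F y"
    proof -
      have "x ^ q = x" "y ^ q = y"
        using eq nz unfolding F1 F_eq[OF nz(1)] F_eq[OF nz(2)] by (simp_all add: field_simps)
      then have "F x = 1" "F y = 1"
        using nz F_eq_one_iff by simp_all
      with sol(1) \<open>b \<noteq> 0\<close> show False
        by simp
    qed
    ultimately show "x + x ^ q = y + y ^ q \<and> x * y ^ q + x ^ q * y = - (x + x ^ q) \<and> F x - F y = b"
      using cross sol(1) by blast
  next
    assume "x + x ^ q = y + y ^ q \<and> x * y ^ q + x ^ q * y = - (x + x ^ q) \<and> F x - F y = b"
    then have "F (x + 1) = - F y" "F (y + 1) = - F x" "F x - F y = b"
      using cross by blast+
    then show "(x, y) \<in> solutions b"
      by (simp add: solutions_def)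
  qed
qed

lemma solution_parameters:
  assumes "q mod 3 \<noteq> 2" "b \<noteq> 0" "(x, y) \<in> solutions b"
  defines "d \<equiv> y - x"
  shows "x + y + 1 = 2 * d / b"
    and "d\<^sup>2 * (4 * (1 / b - 1 / b ^ q) / b - 4 / b\<^sup>2 + 1) = 1"
proof -
  note nz = solution_nonzero[OF assms(1-3)]
  have tr: "x + x ^ q = y + y ^ q" "x * y ^ q + x ^ q * y = - (x + x ^ q)" "F x - F y = b"
    using solution_iff_trace[OF nz assms(2)] assms(3) by blast+
  define t where "t = x + x ^ q"
  have xq: "x ^ q = t - x" "y ^ q = t - y"
    using tr(1) by (auto simp: t_def algebra_simps)
  have prod: "2 * x * y = t * (x + y + 1)"
  proof -
    have "2 * x * y = t * (x + y) - (x * (t - y) + (t - x) * y)"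
      by (simp add: algebra_simps)
    also have "\<dots> = t * (x + y + 1)"
      using tr(2) unfolding xq by (simp add: algebra_simps)
    finally show ?thesis .
  qed
  \<comment> \<open>With \<open>t\<close> the common trace, \<open>F x = t / x - 1\<close> and
    \<open>F y = t / y - 1\<close>.\<close>
  have bxy: "b * (x * y) = t * d"
    using tr(3) nz unfolding F_eq[OF nz(1)] F_eq[OF nz(2)] xq d_def by (auto simp: field_simps)
  have "t \<noteq> 0"
    using bxy nz assms(2) by auto
  have "t * (b * (x + y + 1)) = t * (2 * d)"
  proof -
    have "t * (b * (x + y + 1)) = b * (2 * x * y)"
      unfolding prod by (simp add: algebra_simps)
    also have "\<dots> = 2 * (b * (x * y))"
      by (simp add: algebra_simps)
    finally show ?thesis
      by (simp add: bxy)
  qed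
  with \<open>t \<noteq> 0\<close> have bd: "b * (x + y + 1) = 2 * d"
    by simp
  then show sum: "x + y + 1 = 2 * d / b"
    using assms(2) by (simp add: field_simps)
  have "d ^ q = - d"
    unfolding d_def conj_diff xq by simp
  have two: "(2 :: 'a) ^ q = 2"
    using conj_add[of 1 1] by simp
  \<comment> \<open>Conjugate \<open>bd\<close>; equal traces make \<open>d\<close> skew. Adding the
    result to \<open>sum\<close> eliminates \<open>x + y\<close> and isolates
    \<open>t\<close>.\<close>
  have "b ^ q * (2 * t - (x + y) + 1) = - (2 * d)"
    using arg_cong[OF bd, of "\<lambda>z. z ^ q"] \<open>d ^ q = - d\<close> two
    by (simp add: power_mult_distrib conj_add xq algebra_simps)
  then have "2 * t - (x + y) + 1 = - (2 * d / b ^ q)"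
    using assms(2) by (simp add: field_simps)
  then have "(x + y + 1) + (2 * t - (x + y) + 1) = 2 * d / b - 2 * d / b ^ q"
    unfolding sum by simp
  moreover have "2 * (t + 1) = (x + y + 1) + (2 * t - (x + y) + 1)"
    by (simp add: algebra_simps)
  ultimately have "2 * (t + 1) = 2 * (d * (1 / b - 1 / b ^ q))"
    by (simp only: right_diff_distrib times_divide_eq_right mult_1_right mult.assoc)
  then have t: "t + 1 = d * (1 / b - 1 / b ^ q)"
    using two_neq_zero mult_left_cancel by blast
  \<comment> \<open>This is \<open>(x + y)\<^sup>2 - d\<^sup>2 = 4 * x * y\<close>, rewritten so
    that \<open>prod\<close>, \<open>sum\<close> and \<open>t\<close> leave only \<open>d\<close>
    and \<open>b\<close>.\<close>
  have "(x + y + 1)\<^sup>2 - d\<^sup>2 = 2 * (2 * x * y) + 2 * (x + y + 1) - 1"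
    by (simp add: d_def power2_eq_square algebra_simps)
  also have "\<dots> = 2 * (t + 1) * (x + y + 1) - 1"
    unfolding prod by (simp add: algebra_simps)
  finally have "(2 * d / b)\<^sup>2 - d\<^sup>2 = 2 * (d * (1 / b - 1 / b ^ q)) * (2 * d / b) - 1"
    unfolding sum t .
  moreover have "d\<^sup>2 * (4 * e / b - 4 / b\<^sup>2 + 1) = 2 * (d * e) * (2 * d / b) - ((2 * d / b)\<^sup>2 - d\<^sup>2)" for e
    by (simp add: power2_eq_square algebra_simps)
  ultimately show "d\<^sup>2 * (4 * (1 / b - 1 / b ^ q) / b - 4 / b\<^sup>2 + 1) = 1"
    by (metis diff_diff_eq2 diff_add_cancel add_diff_cancel_left')
qed

text \<open>The difference \<open>y - x\<close> determines the solution, because the sum is a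
  function of it and 2 is invertible; its square is fixed by \<open>b\<close>.\<close>

lemma card_solutions_le:
  assumes "q mod 3 \<noteq> 2" "b \<noteq> 0"
  shows "card (solutions b) \<le> 2"
proof -
  let ?K = "4 * (1 / b - 1 / b ^ q) / b - 4 / b\<^sup>2 + 1"
  let ?d = "\<lambda>(x, y). y - x :: 'a"
  have "inj_on ?d (solutions b)"
  proof (rule inj_onI, clarify)
    fix x y x' y'
    assume "(x, y) \<in> solutions b" "(x', y') \<in> solutions b" and eq: "y - x = y' - x'"
    then have "x + y + 1 = x' + y' + 1"
      using solution_parameters(1)[OF assms] by metis
    moreover have "2 * z = (z + w + 1) - (w - z) - 1" "2 * w = (z + w + 1) + (w - z) - 1" for z w :: 'a
      by simp_all
    ultimately have "2 * x = 2 * x'" "2 * y = 2 * y'"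
      using eq by metis+
    then show "x = x' \<and> y = y'"
      using two_neq_zero by simp
  qed
  \<comment> \<open>Any solution forces \<open>?K \<noteq> 0\<close>, so the default value of
    \<open>1 / ?K\<close> at \<open>?K = 0\<close> only occurs when there are no solutions.\<close>
  moreover have "?d ` solutions b \<subseteq> {d. d\<^sup>2 = 1 / ?K}"
  proof clarify
    fix x y assume "(x, y) \<in> solutions b"
    then have "(y - x)\<^sup>2 * ?K = 1"
      by (rule solution_parameters(2)[OF assms])
    then show "(y - x)\<^sup>2 = 1 / ?K"
      by (metis mult_zero_right nonzero_eq_divide_eq zero_neq_one)
  qed
  ultimately have "card (solutions b) \<le> card {d. d\<^sup>2 = 1 / ?K}"
    by (rule card_inj_on_le) simp
  also have "\<dots> \<le> 2"
    by (rule card_square_roots_le)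
  finally show ?thesis .
qed

section \<open>A pair of solutions for the lower bound\<close>

text \<open>Every \<open>z ^ q - z\<close> is skew. If no suitable \<open>u\<close> existed, all
  \<open>q\<^sup>2\<close> field elements would be roots of \<open>P * (P\<^sup>2 - 2)\<close>,
  which has degree \<open>3 * q < q\<^sup>2\<close>.\<close>

lemma exists_skew:
  assumes "q > 3"
  shows "\<exists>u :: 'a. u ^ q = - u \<and> u \<noteq> 0 \<and> u\<^sup>2 \<noteq> 2"
proof (rule ccontr)
  assume none: "\<nexists>u :: 'a. u ^ q = - u \<and> u \<noteq> 0 \<and> u\<^sup>2 \<noteq> 2"
  define P :: "'a poly" where "P = monom 1 q - monom 1 1"
  have deg: "degree P = q"
    unfolding P_def using q_gt_1
    by (subst diff_conv_add_uminus, subst degree_add_eq_left) (simp_all add: degree_monom_eq)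
  have val: "poly P z = z ^ q - z" for z
    by (simp add: P_def poly_monom)
  have "degree (P\<^sup>2) = 2 * q"
    using deg q_gt_1 by (subst degree_power_eq) auto
  then have deg2: "degree (P\<^sup>2 - [:2:]) = 2 * q"
    using q_gt_1 by (subst diff_conv_add_uminus, subst degree_add_eq_left) simp_all
  have nz: "P \<noteq> 0" "P\<^sup>2 - [:2:] \<noteq> 0"
    using deg deg2 q_gt_1 by force+
  have "poly (P * (P\<^sup>2 - [:2:])) z = 0" for z
  proof -
    have "(z ^ q - z) ^ q = - (z ^ q - z)"
      by (simp add: conj_diff conj_conj)
    then have "z ^ q - z = 0 \<or> (z ^ q - z)\<^sup>2 = 2"
      using none by blast
    then show ?thesis
      by (auto simp: val)
  qed
  then have "CARD('a) = card {z. poly (P * (P\<^sup>2 - [:2:])) z = 0}"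
    by simp
  also have "\<dots> \<le> degree (P * (P\<^sup>2 - [:2:]))"
    by (rule card_poly_roots_bound) (use nz in simp)
  also have "\<dots> = 3 * q"
    using nz deg deg2 by (simp add: degree_mult_eq)
  finally have "q * q \<le> 3 * q"
    by (simp add: card power2_eq_square)
  with assms show False
    by simp
qed

lemma exists_two_solutions:
  assumes "q > 3"
  shows "\<exists>b. b \<noteq> 0 \<and> card (solutions b) \<ge> 2"
proof -
  obtain u :: 'a where u: "u ^ q = - u" "u \<noteq> 0" "u\<^sup>2 \<noteq> 2"
    using exists_skew[OF assms] by blast
  \<comment> \<open>For skew \<open>u\<close> and \<open>v\<close>, the elements
    \<open>1 + u\<close> and \<open>1 + v\<close> have trace 2, and the remaining trace relation
    reads \<open>2 - 2 * u * v = - 2\<close>, that is \<open>u * v = 2\<close>. The condition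
    \<open>u\<^sup>2 \<noteq> 2\<close> then keeps \<open>u\<close> and \<open>v\<close>
    apart.\<close>
  define v where "v = 2 / u"
  define x y where "x = 1 + u" and "y = 1 + v"
  have uv: "u * v = 2"
    using u by (simp add: v_def)
  have two: "(2 :: 'a) ^ q = 2"
    using conj_add[of 1 1] by simp
  have vq: "v ^ q = - v"
    by (simp add: v_def power_divide u(1) two)
  have "u \<noteq> v"
    using uv u(3) by (auto simp: power2_eq_square)
  have conj: "x ^ q = 1 - u" "y ^ q = 1 - v"
    by (simp_all add: x_def y_def conj_add u(1) vq)
  have four: "(4 :: 'a) \<noteq> 0"
    using two_neq_zero by (metis mult_2 mult_eq_0_iff numeral_Bit0)
  have nz: "x \<noteq> 0" "y \<noteq> 0" "x + 1 \<noteq> 0" "y + 1 \<noteq> 0"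
  proof -
    have sums: "x + x ^ q = 2" "y + y ^ q = 2"
      by (simp_all add: conj) (simp_all add: x_def y_def)
    show "x \<noteq> 0" "y \<noteq> 0"
      using sums two_neq_zero q_gt_1 by (auto simp: power_0_left)
    \<comment> \<open>The element \<open>- 1\<close> has trace \<open>- 2\<close>, which differs
      from 2 in odd characteristic.\<close>
    have "z + 1 \<noteq> 0" if "z + z ^ q = 2" for z :: 'a
    proof
      assume "z + 1 = 0"
      then have "z = - 1"
        by (simp add: eq_neg_iff_add_eq_0)
      with that have "(4 :: 'a) = 0"
        by (simp add: conj_minus) algebra
      with four show False ..
    qed
    with sums show "x + 1 \<noteq> 0" "y + 1 \<noteq> 0"
      by blast+
  qed
  define b where "b = F x - F y"
  have "b * (x * y) = 2 * (v - u)"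
    using nz unfolding b_def F_eq[OF nz(1)] F_eq[OF nz(2)] conj
    by (simp add: field_simps) (simp add: x_def y_def algebra_simps)
  then have "b \<noteq> 0"
    using \<open>u \<noteq> v\<close> two_neq_zero by auto
  have "(x, y) \<in> solutions b"
    unfolding solution_iff_trace[OF nz \<open>b \<noteq> 0\<close>] conj
    using uv unfolding b_def x_def y_def by (simp add: algebra_simps)
  then have sub: "{(x, y), (- 1 - x, - 1 - y)} \<subseteq> solutions b"
    using solutions_reflect by simp
  \<comment> \<open>A fixed point of the reflection has both coordinates equal to
    \<open>- 1 / 2\<close>, whereas \<open>x \<noteq> y\<close>.\<close>
  have "(x, y) \<noteq> (- 1 - x, - 1 - y)"
  proof
    assume "(x, y) = (- 1 - x, - 1 - y)"
    then have "2 * x = - 1" "2 * y = - 1"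
      by (auto simp: algebra_simps eq_diff_eq)
    then have "x = y"
      using two_neq_zero by (metis mult_left_cancel)
    then show False
      using \<open>u \<noteq> v\<close> by (simp add: x_def y_def)
  qed
  then have "2 = card {(x, y), (- 1 - x, - 1 - y)}"
    by simp
  also have "\<dots> \<le> card (solutions b)"
    by (rule card_mono[OF _ sub]) simp
  finally show ?thesis
    using \<open>b \<noteq> 0\<close> by blast
qed

section \<open>The boomerang uniformity\<close>

lemma boomerang_count_eq_card_solutions: "boomerang_count F 1 b = card (solutions b)"
  by (simp add: boomerang_count_def solutions_def)

lemma boomerang_count_scale:
  "a \<noteq> 0 \<Longrightarrow> boomerang_count F a b \<le> boomerang_count F 1 (b / F a)"
  unfolding F_def by (rule boomerang_count_power_scale)

lemma boomerang_uniformity_eq_2: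
  assumes "q mod 3 \<noteq> 2" "q > 3"
  shows "boomerang_uniformity F = 2"
proof -
  have le: "boomerang_count F a b \<le> 2" if "a \<noteq> 0" "b \<noteq> 0" for a b
  proof -
    have "boomerang_count F a b \<le> card (solutions (b / F a))"
      using boomerang_count_scale[OF that(1)] boomerang_count_eq_card_solutions by metis
    also have "\<dots> \<le> 2"
      using that by (intro card_solutions_le assms) (simp add: F_eq_zero_iff)
    finally show ?thesis .
  qed
  obtain b where b: "b \<noteq> 0" "card (solutions b) \<ge> 2"
    using exists_two_solutions[OF assms(2)] by blast
  then have "boomerang_count F 1 b = 2"
    using le[of 1 b] by (simp add: boomerang_count_eq_card_solutions)
  then have "2 \<in> {boomerang_count F a b | a b. a \<noteq> 0 \<and> b \<noteq> 0}"
    using b(1) by (metis (mono_tags, lifting) mem_Collect_eq zero_neq_one)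
  moreover have "finite {boomerang_count F a b | a b. a \<noteq> 0 \<and> b \<noteq> 0}"
    by (rule finite_subset[of _ "{..2}"]) (use le in auto)
  ultimately show ?thesis
    unfolding boomerang_uniformity_def using le by (intro Max_eqI) auto
qed

end

text \<open>The case \<open>q = 3\<close> is genuinely exceptional: there the map is squaring, the
  two equations differ by \<open>2 * a * (x - y) = 0\<close>, so \<open>x = y\<close>, contradicting
  \<open>b \<noteq> 0\<close>, and the uniformity is 0.\<close>

theorem theorem3p1:
  fixes q :: nat
  assumes "primepow q" and "odd q"
    and "q mod 3 \<noteq> 2"
    and "q \<noteq> 3"
    and "CARD('a :: {field, finite}) = q\<^sup>2"
  shows "boomerang_uniformity (\<lambda>x :: 'a. x ^ (q - 1)) = 2"
proof -
  interpret odd_quadratic_extension q "TYPE('a)"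
    by unfold_locales (use assms in auto)
  show ?thesis
    using boomerang_uniformity_eq_2 assms(3,4) q_ge_3 by (simp add: F_def[abs_def])
qed

end
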